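(* Let $\boldsymbol{r}=(r_n)_{n=1}^\infty=(2,3,2,4,2,3,2,5,\ldots)$ be the sequence where $r_n$ is the number of divisors of $2n$ of the form $2^k$ with $k\ge0$. Let $\boldsymbol{\tilde p}=(\tilde p_n)_{n=1}^\infty=(1,2,4,8,14,\ldots)$, where $\tilde p_n$ is the number of partitions of the integer $n-1$ in which there are two kinds of odd parts. Then $\phi(\boldsymbol{r})=\boldsymbol{\tilde p}$, where $\phi$ is the map on integer sequences defined in the context.
   Context: For a sequence $\boldsymbol{a}=(a_n)_{n=1}^\infty$ of integers, $\phi(\boldsymbol{a})=\boldsymbol{u}$ is the sequence $(u_n)_{n=1}^\infty$ with ordinary generating function $\sum_{h=0}^\infty u_{h+1}t^h=\prod_{k=1}^\infty(1+t^k)^{a_k}$, as formal power series. In a partition with two kinds of odd parts, each odd part is assigned one of two colours and even parts have one colour only; partitions are multisets of such coloured parts. *)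

theory Defs
  imports
    "HOL-Analysis.Infinite_Products"
    "HOL-Computational_Algebra.Formal_Power_Series"
    "HOL-Library.Multiset"
begin

text \<open>
  A sequence \<open>(a\<^sub>n)\<close>, \<open>n \<ge> 1\<close>, of integers is a function of type \<^typ>\<open>nat \<Rightarrow> int\<close> of which only the
  values at positive arguments matter.
\<close>

text \<open>
  Integer powers of an integral power series with constant term 1. The general operator \<open>powi\<close>
  is not available over \<^typ>\<open>int\<close>, since \<^typ>\<open>int\<close> is not in class \<open>inverse\<close>;
  \<open>fps_right_inverse g 1\<close> is the multiplicative inverse of a series \<open>g\<close> with constant term 1.
\<close>

definition fps_zpow :: "int fps \<Rightarrow> int \<Rightarrow> int fps" where
  "fps_zpow f a = (if a \<ge> 0 then f ^ nat a else fps_right_inverse (f ^ nat (- a)) 1)"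

lemma fps_zpow_nonneg: "a \<ge> 0 \<Longrightarrow> fps_zpow f a = f ^ nat a"
  by (simp add: fps_zpow_def)

lemma fps_zpow_neg:
  assumes "fps_nth f 0 = 1" "a < 0"
  shows "f ^ nat (- a) * fps_zpow f a = 1"
  using assms by (simp add: fps_zpow_def fps_right_inverse fps_nth_power_0)

text \<open>
  The infinite product is the limit of the partial products in the metric on formal power series,
  that is, coefficientwise eventual stabilisation. The factor with index \<open>k\<close> in \<open>\<Prod>k\<close> (which
  starts at 0) is the one for \<open>k + 1\<close>, and the \<open>n\<close>-th term of the resulting sequence is the
  coefficient of \<open>t ^ (n - 1)\<close>. The value at \<open>n = 0\<close> is meaningless.
\<close>

definition phi_series :: "(nat \<Rightarrow> int) \<Rightarrow> int fps" where
  "phi_series a = (\<Prod>k. fps_zpow (1 + fps_X ^ Suc k) (a (Suc k)))"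

definition phi :: "(nat \<Rightarrow> int) \<Rightarrow> nat \<Rightarrow> int" where
  "phi a n = fps_nth (phi_series a) (n - 1)"

definition r_seq :: "nat \<Rightarrow> int" where
  "r_seq n = int (card {d. d dvd 2 * n \<and> (\<exists>k. d = 2 ^ k)})"

datatype colour = First | Second

text \<open>Even parts only come in the colour \<^const>\<open>First\<close>.\<close>

definition coloured_partitions :: "nat \<Rightarrow> (nat \<times> colour) multiset set" where
  "coloured_partitions m =
     {P. (\<forall>(j, c) \<in># P. j > 0 \<and> (even j \<longrightarrow> c = First)) \<and> (\<Sum>(j, c) \<in># P. j) = m}"

definition p_seq :: "nat \<Rightarrow> int" where
  "p_seq n = int (card (coloured_partitions (n - 1)))"

text \<open>The infinite product always converges, and the sets of partitions counted are finite.\<close>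

lemma fps_zpow_cong_1:
  fixes g :: "int fps"
  assumes "d > 0"
  shows "\<exists>h. fps_zpow (1 + fps_X ^ d * g) a = 1 + fps_X ^ d * h"
proof -
  have pow: "\<exists>h. (1 + fps_X ^ d * g) ^ n = 1 + fps_X ^ d * h" for n
  proof (induction n)
    case 0
    show ?case by (rule exI[of _ 0]) simp
  next
    case (Suc n)
    then obtain h where h: "(1 + fps_X ^ d * g) ^ n = 1 + fps_X ^ d * h" by blast
    show ?case
      unfolding power_Suc h
      by (rule exI[of _ "g + h + fps_X ^ d * g * h"]) (simp add: algebra_simps)
  qed
  show ?thesis
  proof (cases "a \<ge> 0")
    case True
    then show ?thesis using pow by (simp add: fps_zpow_nonneg)
  next
    case False
    obtain h where h: "(1 + fps_X ^ d * g) ^ nat (- a) = 1 + fps_X ^ d * h"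
      using pow by blast
    have "(1 + fps_X ^ d * h) * fps_zpow (1 + fps_X ^ d * g) a = 1"
      using fps_zpow_neg[of "1 + fps_X ^ d * g" a] False assms h by simp
    then have "fps_zpow (1 + fps_X ^ d * g) a =
        1 + fps_X ^ d * (- h * fps_zpow (1 + fps_X ^ d * g) a)"
      by (simp add: algebra_simps)
    then show ?thesis by blast
  qed
qed

lemma phi_series_has_prod:
  "(\<lambda>k. fps_zpow (1 + fps_X ^ Suc k) (a (Suc k))) has_prod phi_series a"
proof -
  define f where "f = (\<lambda>k. fps_zpow (1 + fps_X ^ Suc k) (a (Suc k)))"
  define P where "P = (\<lambda>n. \<Prod>k\<le>n. f k)"
  have step: "fps_nth (P (Suc n)) m = fps_nth (P n) m" if "m < Suc (Suc n)" for n m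
  proof -
    obtain h where "f (Suc n) = 1 + fps_X ^ Suc (Suc n) * h"
      using fps_zpow_cong_1[of "Suc (Suc n)" 1 "a (Suc (Suc n))"] by (auto simp: f_def)
    then have "P (Suc n) = P n + fps_X ^ Suc (Suc n) * (h * P n)"
      by (simp add: P_def algebra_simps)
    then show ?thesis using that by (simp only: fps_add_nth fps_X_power_mult_nth) simp
  qed
  have stable: "fps_nth (P n) m = fps_nth (P m) m" if "n \<ge> m" for n m
    using that by (induction n rule: dec_induct) (simp_all add: step)
  define L where "L = Abs_fps (\<lambda>m. fps_nth (P m) m)"
  have "P \<longlonglongrightarrow> L"
    by (rule tendsto_fpsI) (auto simp: L_def eventually_sequentially intro: stable)
  moreover have "fps_nth L 0 = 1"
  proof -
    have "P 0 = f 0" by (simp add: P_def)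
    then show ?thesis by (simp add: L_def f_def fps_zpow_def fps_nth_power_0)
  qed
  then have "L \<noteq> 0" by auto
  ultimately have "f has_prod L"
    by (simp add: has_prod_def raw_has_prod_def P_def)
  then show ?thesis
    unfolding phi_series_def f_def by (metis has_prod_unique)
qed

lemma finite_coloured_partitions: "finite (coloured_partitions m)"
proof (rule finite_subset)
  have "finite (UNIV :: colour set)"
    by (rule finite_subset[of _ "{First, Second}"]) (use colour.exhaust in auto)
  then show "finite (mset ` {xs. set xs \<subseteq> {..m} \<times> (UNIV :: colour set) \<and> length xs \<le> m})"
    by (intro finite_imageI finite_lists_length_le) simp
  show "coloured_partitions m \<subseteq> mset ` {xs. set xs \<subseteq> {..m} \<times> UNIV \<and> length xs \<le> m}"
  proof
    fix P assume P: "P \<in> coloured_partitions m"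
    obtain xs where xs: "P = mset xs" by (metis ex_mset)
    have fst_eq: "(\<lambda>(j, c). j) = (fst :: nat \<times> colour \<Rightarrow> nat)"
      by auto
    have sum: "sum_list (map fst xs) = m"
      using P by (simp add: xs coloured_partitions_def fst_eq flip: sum_mset_sum_list)
    have "length xs \<le> sum_list (map fst xs)" if "\<forall>x\<in>set xs. fst x > 0"
      using that by (induction xs) (auto simp: Suc_le_eq)
    moreover have "\<forall>x\<in>set xs. fst x > 0"
      using P by (auto simp: xs coloured_partitions_def)
    moreover have "fst x \<le> m" if "x \<in> set xs" for x
      using member_le_sum_list[of "fst x" "map fst xs"] that by (simp add: sum)
    ultimately show "P \<in> mset ` {xs. set xs \<subseteq> {..m} \<times> UNIV \<and> length xs \<le> m}"
      using sum by (auto simp: xs intro!: imageI)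
  qed
qed

end

theory Submission
  imports Defs
begin

text \<open>
  Let \<open>d\<^sub>n\<close> be the number of kinds of the part \<open>n\<close>, so that the partitions have the generating
  function \<open>\<Prod>\<^sub>n (1 - t\<^sup>n)\<close> to the powers \<open>- d\<^sub>n\<close>. Since \<open>r\<^sub>m - d\<^sub>m\<close> vanishes for odd \<open>m\<close> and equals
  \<open>r\<^sub>n\<close> for \<open>m = 2 n\<close>, multiplying out \<open>(1 + t\<^sup>n) (1 - t\<^sup>n) = 1 - t\<^bsup>2 n\<^esup>\<close> over \<open>n \<le> N\<close> with exponents
  \<open>r\<^sub>n\<close> gives the product of \<open>1 - t\<^sup>m\<close> over \<open>m \<le> 2 N\<close> with exponents \<open>r\<^sub>m - d\<^sub>m\<close>. Cancelling
  the factors with \<open>m \<le> N\<close> shows that the two truncated generating functions agree up to a product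
  of factors \<open>1 - t\<^sup>m\<close> with \<open>m > N\<close>.
\<close>

definition weighted_multisets :: "('a \<Rightarrow> nat) \<Rightarrow> 'a set \<Rightarrow> nat \<Rightarrow> 'a multiset set" where
  "weighted_multisets w A m = {P. set_mset P \<subseteq> A \<and> (\<Sum>x\<in>#P. w x) = m}"

lemma weighted_multisets_empty: "weighted_multisets w {} m = (if m = 0 then {{#}} else {})"
  by (auto simp: weighted_multisets_def)

text \<open>Split by whether \<open>x\<close> occurs. If it does, one copy is removed; further
  copies may remain, so the second term keeps \<open>insert x A\<close>.\<close>

lemma weighted_multisets_insert:
  "weighted_multisets w (insert x A) m = weighted_multisets w A m \<union>
     (if w x \<le> m then add_mset x ` weighted_multisets w (insert x A) (m - w x) else {})"
  (is "?L = ?R")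
proof
  show "?L \<subseteq> ?R"
  proof
    fix P assume P: "P \<in> ?L"
    show "P \<in> ?R"
    proof (cases "x \<in># P")
      case True
      then obtain Q where "P = add_mset x Q" by (metis insert_DiffM)
      with P show ?thesis by (auto simp: weighted_multisets_def)
    next
      case False
      with P show ?thesis by (auto simp: weighted_multisets_def)
    qed
  qed
  show "?R \<subseteq> ?L" by (auto simp: weighted_multisets_def split: if_splits)
qed

text \<open>Since \<open>w x > 0\<close>, the recursion over \<open>insert x A\<close> lowers the
  total weight, whence the strong induction on \<open>m\<close>.\<close>

lemma finite_weighted_multisets_insert:
  assumes "\<And>m. finite (weighted_multisets w A m)" "w x > 0"
  shows "finite (weighted_multisets w (insert x A) m)"
proof (induction m rule: less_induct)
  case (less m)
  show ?case
    using assms less[of "m - w x"] by (subst weighted_multisets_insert) auto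
qed

lemma finite_weighted_multisets:
  assumes "finite A" "\<And>x. x \<in> A \<Longrightarrow> w x > 0"
  shows "finite (weighted_multisets w A m)"
  using assms
  by (induction A arbitrary: m)
    (simp_all add: weighted_multisets_empty finite_weighted_multisets_insert)

lemma card_weighted_multisets_insert:
  assumes "finite A" "\<And>y. y \<in> insert x A \<Longrightarrow> w y > 0" "x \<notin> A"
  shows "card (weighted_multisets w (insert x A) m) = card (weighted_multisets w A m) +
     (if w x \<le> m then card (weighted_multisets w (insert x A) (m - w x)) else 0)"
proof -
  have "finite (weighted_multisets w A k)" "finite (weighted_multisets w (insert x A) k)" for k
    using assms by (auto intro: finite_weighted_multisets)
  moreover have "weighted_multisets w A m \<inter> add_mset x ` B = {}" for B
    using assms(3) by (auto simp: weighted_multisets_def)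
  ultimately show ?thesis
    by (subst weighted_multisets_insert) (simp add: card_Un_disjoint card_image inj_on_def)
qed

text \<open>The counting recursion says that the factor \<open>1 - fps_X ^ w x\<close> removes
  \<open>x\<close> from the set. A product equal to 1 expresses this without inverse series.\<close>

lemma weighted_multisets_gf:
  assumes "finite A" "\<And>x. x \<in> A \<Longrightarrow> w x > 0"
  shows "Abs_fps (\<lambda>m. int (card (weighted_multisets w A m))) * (\<Prod>x\<in>A. 1 - fps_X ^ w x) = 1"
  using assms
proof (induction A)
  case empty
  show ?case by (auto simp: fps_eq_iff weighted_multisets_empty)
next
  case (insert x A)
  let ?g = "\<lambda>A. Abs_fps (\<lambda>m. int (card (weighted_multisets w A m)))"
  have card: "card (weighted_multisets w (insert x A) m) = card (weighted_multisets w A m) +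
     (if w x \<le> m then card (weighted_multisets w (insert x A) (m - w x)) else 0)" for m
    using insert.hyps insert.prems by (intro card_weighted_multisets_insert)
  have "?g (insert x A) = ?g A + fps_X ^ w x * ?g (insert x A)"
    by (rule fps_ext) (simp add: card fps_X_power_mult_nth)
  then have "?g (insert x A) * (1 - fps_X ^ w x) = ?g A"
    by (simp add: algebra_simps)
  then show ?case
    using insert by (simp flip: mult.assoc)
qed

text \<open>Each factor differs from 1 only in degrees above \<open>i\<close>.\<close>

lemma fps_nth_mult_prod_high_order:
  fixes g :: "'a::comm_ring_1 fps"
  assumes "finite M" "\<And>m. m \<in> M \<Longrightarrow> i < m"
  shows "fps_nth (g * (\<Prod>m\<in>M. (1 - fps_X ^ m) ^ e m)) i = fps_nth g i"
  using assms
proof (induction M arbitrary: g)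
  case (insert m M)
  have pow: "fps_nth (h * (1 - fps_X ^ m) ^ k) i = fps_nth h i" for h :: "'a fps" and k
  proof (induction k)
    case (Suc k)
    have "h * (1 - fps_X ^ m) ^ Suc k
        = h * (1 - fps_X ^ m) ^ k - fps_X ^ m * (h * (1 - fps_X ^ m) ^ k)"
      by (simp add: algebra_simps)
    then show ?case
      using Suc insert.prems by (simp add: fps_X_power_mult_nth)
  qed simp
  show ?case
    using insert pow[of g "e m"] by (simp flip: mult.assoc)
qed simp

definition kinds :: "nat \<Rightarrow> colour set" where
  "kinds j = (if even j then {First} else {First, Second})"

text \<open>No part exceeds the total \<open>m\<close>, so bounding the parts by \<open>N\<close>
  loses nothing and makes the set of available parts finite.\<close>

lemma coloured_partitions_eq_weighted_multisets:
  assumes "m \<le> N"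
  shows "coloured_partitions m = weighted_multisets fst (Sigma {1..N} kinds) m"
proof -
  have fst_eq: "(\<lambda>(j, c). j) = (fst :: nat \<times> colour \<Rightarrow> nat)"
    by auto
  have kinds: "c \<in> kinds j \<longleftrightarrow> (even j \<longrightarrow> c = First)" for c j
    by (cases c) (auto simp: kinds_def)
  have "fst x \<le> (\<Sum>y\<in>#P. fst y)" if "x \<in># P" for P :: "(nat \<times> colour) multiset" and x
    using that by (metis insert_DiffM image_mset_add_mset sum_mset.add_mset le_add1)
  then show ?thesis
    using assms
    by (fastforce simp: coloured_partitions_def weighted_multisets_def fst_eq kinds Suc_le_eq)
qed

text \<open>The values of \<open>r_seq\<close> as natural numbers, to serve as exponents of ordinary
  powers.\<close>

definition twos :: "nat \<Rightarrow> nat" where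
  "twos n = card {d. d dvd 2 * n \<and> (\<exists>k. d = 2 ^ k)}"

lemma twos_odd:
  assumes "odd n"
  shows "twos n = 2"
proof -
  have "k = 0 \<or> k = 1" if "2 ^ k dvd 2 * n" for k :: nat
  proof (cases k)
    case (Suc j)
    with that assms show ?thesis by (cases j) (auto dest: dvd_mult_left)
  qed simp
  then have "{d. d dvd 2 * n \<and> (\<exists>k. d = 2 ^ k)} = {1, 2}"
    by (fastforce intro: exI[of _ 0] exI[of _ 1])
  then show ?thesis by (simp add: twos_def)
qed

text \<open>Doubling maps the powers of two dividing \<open>2 * n\<close> onto those dividing
  \<open>4 * n\<close> other than 1.\<close>

lemma twos_double:
  assumes "n > 0"
  shows "twos (2 * n) = Suc (twos n)"
proof -
  let ?D = "\<lambda>n. {d. d dvd 2 * n \<and> (\<exists>k. d = 2 ^ k)}"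
  have "?D (2 * n) = insert 1 ((*) 2 ` ?D n)"
  proof (intro set_eqI iffI)
    fix d assume "d \<in> ?D (2 * n)"
    then obtain k where k: "d = 2 ^ k" "2 ^ k dvd 2 * (2 * n)" by auto
    then show "d \<in> insert 1 ((*) 2 ` ?D n)" by (cases k) auto
  next
    fix d assume "d \<in> insert 1 ((*) 2 ` ?D n)"
    then show "d \<in> ?D (2 * n)" by (auto intro: exI[of _ 0] exI[of _ "Suc _"])
  qed
  \<comment> \<open>This needs \<open>n > 0\<close>: every power of two divides 0.\<close>
  moreover have "finite (?D n)"
    by (rule finite_subset[of _ "{..2 * n}"]) (use assms in \<open>auto dest: dvd_imp_le\<close>)
  ultimately show ?thesis
    by (simp add: twos_def card_image inj_on_def image_iff)
qed

lemma twos_eq_double_excess: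
  assumes "n > 0"
  shows "twos (2 * n) - card (kinds (2 * n)) = twos n"
  using assms by (simp add: twos_double kinds_def)

lemma card_kinds_odd: "odd n \<Longrightarrow> card (kinds n) = twos n"
  by (simp add: twos_odd kinds_def)

text \<open>Ensures that the natural number subtraction in the exponents
  \<open>twos n - card (kinds n)\<close> is never truncated.\<close>

lemma card_kinds_le_twos:
  assumes "n > 0"
  shows "card (kinds n) \<le> twos n"
proof (cases "even n")
  case True
  then show ?thesis using assms by (auto elim!: evenE simp: twos_double kinds_def)
qed (simp add: card_kinds_odd)

lemma twos_product:
  defines "e \<equiv> \<lambda>n. twos n - card (kinds n)"
  shows "(\<Prod>n=1..N. (1 + fps_X ^ n) ^ twos n) * (\<Prod>n=1..N. (1 - fps_X ^ n) ^ card (kinds n))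
    = (\<Prod>n\<in>{N<..2*N}. (1 - fps_X ^ n :: int fps) ^ e n)" (is "?P * ?D = ?R")
proof -
  let ?f = "\<lambda>n. (1 - fps_X ^ n :: int fps) ^ e n"
  \<comment> \<open>The extra factors raise the exponent of each \<open>1 - fps_X ^ n\<close> from
    \<open>card (kinds n)\<close> to \<open>twos n\<close>, to match that of
    \<open>1 + fps_X ^ n\<close>.\<close>
  have "?P * ?D * (\<Prod>n=1..N. ?f n) = (\<Prod>n=1..N. ?f (2 * n))"
    unfolding prod.distrib[symmetric]
  proof (rule prod.cong)
    fix n assume "n \<in> {1..N}"
    then have n: "n > 0" by simp
    then have "(1 - fps_X ^ n :: int fps) ^ card (kinds n) * ?f n = (1 - fps_X ^ n) ^ twos n"
      by (simp add: e_def card_kinds_le_twos flip: power_add)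
    moreover have "(1 + fps_X ^ n) * (1 - fps_X ^ n) = (1 - fps_X ^ (2 * n) :: int fps)"
      unfolding mult_2 power_add by (simp add: ring_distribs)
    ultimately show "(1 + fps_X ^ n) ^ twos n * (1 - fps_X ^ n) ^ card (kinds n) * ?f n
        = ?f (2 * n)"
      using n by (simp add: e_def twos_eq_double_excess mult.assoc flip: power_mult_distrib)
  qed simp
  also have "\<dots> = (\<Prod>n\<in>(*) 2 ` {1..N}. ?f n)"
    by (simp add: prod.reindex inj_on_def)
  \<comment> \<open>The added indices are odd, where the exponent \<open>e n\<close> is 0.\<close>
  also have "\<dots> = (\<Prod>n=1..2*N. ?f n)"
  proof (rule prod.mono_neutral_left)
    show "\<forall>n\<in>{1..2*N} - (*) 2 ` {1..N}. ?f n = 1"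
    proof
      fix n assume n: "n \<in> {1..2*N} - (*) 2 ` {1..N}"
      have "odd n"
      proof
        assume "even n"
        then obtain k where "n = 2 * k" by (rule evenE)
        with n show False by auto
      qed
      then show "?f n = 1" by (simp add: e_def card_kinds_odd)
    qed
  qed auto
  also have "{1..2*N} = {1..N} \<union> {N<..2*N}" by auto
  also have "(\<Prod>n\<in>\<dots>. ?f n) = (\<Prod>n=1..N. ?f n) * ?R"
    by (rule prod.union_disjoint) auto
  finally have "(\<Prod>n=1..N. ?f n) * (?P * ?D) = (\<Prod>n=1..N. ?f n) * ?R"
    by (simp add: mult.commute)
  \<comment> \<open>Integral power series form a domain, so nonzero factors suffice for
    cancelling.\<close>
  moreover have "(\<Prod>n=1..N. ?f n) \<noteq> 0"
  proof -
    have "?f n \<noteq> 0" if "n > 0" for n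
    proof -
      have "fps_nth (1 - fps_X ^ n :: int fps) 0 = 1" using that by simp
      then have "1 - fps_X ^ n \<noteq> (0 :: int fps)" by (metis fps_zero_nth zero_neq_one)
      then show ?thesis by simp
    qed
    then show ?thesis by auto
  qed
  ultimately show ?thesis by (rule mult_left_cancel[THEN iffD1, rotated])
qed

lemma twos_product_nth:
  assumes "m \<le> N"
  shows "fps_nth (\<Prod>n=1..N. (1 + fps_X ^ n) ^ twos n) m = int (card (coloured_partitions m))"
proof -
  let ?S = "Sigma {1..N} kinds"
  define g where "g = Abs_fps (\<lambda>m. int (card (weighted_multisets fst ?S m)))"
  define P where "P = (\<Prod>n=1..N. (1 + fps_X ^ n :: int fps) ^ twos n)"
  define D where "D = (\<Prod>n=1..N. (1 - fps_X ^ n :: int fps) ^ card (kinds n))"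
  have fin: "finite (kinds n)" for n by (simp add: kinds_def)
  have "D = (\<Prod>x\<in>?S. 1 - fps_X ^ fst x)"
    using prod.Sigma[of "{1..N}" kinds "\<lambda>j c. 1 - fps_X ^ j :: int fps"] fin
    by (simp add: D_def case_prod_unfold)
  then have "g * D = 1"
    unfolding g_def using fin by (auto intro!: weighted_multisets_gf)
  \<comment> \<open>Inserting \<open>g * D = 1\<close> produces \<open>P * D\<close>, whose
    remaining factors have index above \<open>N\<close> and do not affect coefficient
    \<open>m\<close>.\<close>
  then have "fps_nth P m = fps_nth (g * (P * D)) m" by (simp add: mult.left_commute)
  also have "P * D = (\<Prod>n\<in>{N<..2*N}. (1 - fps_X ^ n) ^ (twos n - card (kinds n)))"
    unfolding P_def D_def by (rule twos_product)
  also have "fps_nth (g * \<dots>) m = fps_nth g m"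
    using assms by (intro fps_nth_mult_prod_high_order) auto
  finally have "fps_nth P m = fps_nth g m" .
  then show ?thesis
    using assms by (simp add: P_def g_def coloured_partitions_eq_weighted_multisets[of m N])
qed

text \<open>Convergence of power series means that each coefficient is eventually constant. The
  product over \<open>k \<le> N\<close> ends with the factor of index \<open>Suc N\<close>.\<close>

lemma fps_nth_phi_series:
  "\<forall>\<^sub>F N in sequentially.
     fps_nth (\<Prod>n=1..Suc N. fps_zpow (1 + fps_X ^ n) (a n)) m = fps_nth (phi_series a) m"
proof -
  have "(\<lambda>N. \<Prod>k\<le>N. fps_zpow (1 + fps_X ^ Suc k) (a (Suc k))) \<longlonglongrightarrow> phi_series a"
    by (rule has_prod_imp_tendsto[OF phi_series_has_prod])
  moreover have "(\<Prod>k\<le>N. fps_zpow (1 + fps_X ^ Suc k) (a (Suc k)))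
      = (\<Prod>n=1..Suc N. fps_zpow (1 + fps_X ^ n) (a n))" for N
    using prod.shift_bounds_cl_Suc_ivl[of "\<lambda>n. fps_zpow (1 + fps_X ^ n) (a n)" 0 N]
    by (simp add: atLeast0AtMost)
  ultimately show ?thesis
    by (simp only: tendsto_fps_iff)
qed

theorem proposition5:
  shows "\<forall>n\<ge>1. phi r_seq n = p_seq n"
proof (intro allI impI)
  fix n :: nat
  \<comment> \<open>One \<open>N\<close> must serve both the stabilised coefficient and the
    truncated identity.\<close>
  have "\<forall>\<^sub>F N in sequentially. n - 1 \<le> Suc N \<and>
      fps_nth (\<Prod>k=1..Suc N. fps_zpow (1 + fps_X ^ k) (r_seq k)) (n - 1)
        = fps_nth (phi_series r_seq) (n - 1)"
    by (intro eventually_conj fps_nth_phi_series) (auto intro: eventually_sequentiallyI[of n])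
  then obtain N where N: "n - 1 \<le> Suc N"
      "fps_nth (\<Prod>k=1..Suc N. fps_zpow (1 + fps_X ^ k) (r_seq k)) (n - 1)
        = fps_nth (phi_series r_seq) (n - 1)"
    by (auto simp only: eventually_sequentially)
  have "fps_zpow f (r_seq k) = f ^ twos k" for f k
    by (simp add: fps_zpow_def r_seq_def twos_def)
  with N show "phi r_seq n = p_seq n"
    by (simp only: phi_def p_seq_def twos_product_nth)
qed

end
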